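(* Let $L=\mathbb{F}_{2^n}$ with $n$ a positive integer, let $k$ be a positive integer, and let $f(x)=x^{2^{2k}-2^k+1}+h(x)\in L[x]$, where $d=\deg(h)<2^{2k}-2^k+1$ and $d\equiv 3\pmod 4$. Then the polynomial $$\phi(x,y,z)=\frac{f(x)+f(y)+f(z)+f(x+y+z)}{(x+y)(x+z)(y+z)}$$ is absolutely irreducible.
   Context: In characteristic 2 the displayed quotient $\phi(x,y,z)$ is a polynomial in $L[x,y,z]$. A polynomial over $L$ is absolutely irreducible if it is irreducible over the algebraic closure $\overline{\mathbb{F}}_2$. *)

theory Defs
  imports "HOL-Algebra.Algebraic_Closure_Type" "HOL-Number_Theory.Residues"
begin

(* L[x,y,z] is rendered as the iterated polynomial ring L[x][y][z]:
   x is the innermost variable, z the outermost. *)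
type_synonym 'a poly3 = "'a poly poly poly"

definition const3 :: "'a::zero \<Rightarrow> 'a poly3" where
  "const3 c = [:[:[:c:]:]:]"

definition var_x :: "'a::comm_semiring_1 poly3" where "var_x = [:[:[:0, 1:]:]:]"
definition var_y :: "'a::comm_semiring_1 poly3" where "var_y = [:[:0, 1:]:]"
definition var_z :: "'a::comm_semiring_1 poly3" where "var_z = [:0, 1:]"

definition subst3 :: "'a::comm_semiring_1 poly \<Rightarrow> 'a poly3 \<Rightarrow> 'a poly3" where
  "subst3 f p = poly (map_poly const3 f) p"

definition phi_num :: "'a::comm_semiring_1 poly \<Rightarrow> 'a poly3" where
  "phi_num f = subst3 f var_x + subst3 f var_y + subst3 f var_z
     + subst3 f (var_x + var_y + var_z)"

definition phi_den :: "'a::comm_semiring_1 poly3" where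
  "phi_den = (var_x + var_y) * (var_x + var_z) * (var_y + var_z)"

(* In characteristic 2 this division is exact: see phi_mult_den below. *)
definition phi :: "'a::field poly \<Rightarrow> 'a poly3" where
  "phi f = phi_num f div phi_den"

(* The algebraic closure of the coefficient field is used. For a finite field of
   characteristic 2 it is an algebraic closure of the prime field as well:
   see alg_closure_char_2 below. *)
definition absolutely_irreducible :: "'a::field poly3 \<Rightarrow> bool" where
  "absolutely_irreducible p \<longleftrightarrow>
     Factorial_Ring.irreducible (map_poly (map_poly (map_poly to_ac)) p)"

lemma CHAR_eq_2:
  assumes "card (UNIV :: 'a::field set) = 2 ^ n"
  shows "CHAR('a) = 2"
proof -
  have "CHAR('a) dvd 2 ^ n" using CHAR_dvd_CARD[where ?'a = 'a] assms by simp
  moreover from this have "CHAR('a) > 0" by (auto intro: Nat.gr0I)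
  then have "prime CHAR('a)" by (rule prime_CHAR_semidom)
  ultimately show ?thesis
    by (metis prime_dvd_power two_is_prime_nat primes_dvd_imp_eq)
qed

lemma poly_diff_dvd:
  fixes p :: "'a::comm_ring_1 poly"
  shows "(a - b) dvd (poly p a - poly p b)"
proof (induction p)
  case (pCons c p)
  have "poly (pCons c p) a - poly (pCons c p) b
      = (a - b) * poly p a + b * (poly p a - poly p b)"
    by (simp add: algebra_simps)
  then show ?case using pCons by (metis dvd_add dvd_mult dvd_triv_left)
qed simp

lemma phi_den_nonzero: "(phi_den :: 'a::field poly3) \<noteq> 0"
  by (auto simp: phi_den_def var_x_def var_y_def var_z_def)

lemma phi_den_dvd_num:
  fixes f :: "'a::field poly"
  assumes "CHAR('a) = 2"
  shows "phi_den dvd phi_num f"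
proof -
  let ?x = "var_x :: 'a poly3" and ?y = "var_y :: 'a poly3" and ?z = "var_z :: 'a poly3"
  define g where "g = subst3 f"
  have ch: "CHAR('a poly3) = 2" using assms by simp
  have minus: "a - b = a + b" for a b :: "'a poly3"
    by (rule minus_CHAR_2[OF ch])
  have dbl: "a + a = 0" for a :: "'a poly3"
    using minus[of a a] by simp
  have dbl': "a + (a + b) = b" for a b :: "'a poly3"
    using dbl[of a] by (metis add.assoc add_0)
  have g: "(a + b) dvd (g a + g b)" for a b
    using poly_diff_dvd[of a b "map_poly const3 f"] by (simp add: g_def subst3_def minus)
  have num: "phi_num f = g ?x + g ?y + g ?z + g (?x + ?y + ?z)"
    by (simp add: phi_num_def g_def)
  have 1: "(?x + ?z) dvd phi_num f"
  proof -
    have "(?x + ?z) dvd (g ?y + g (?x + ?y + ?z))"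
      using g[of ?y "?x + ?y + ?z"] by (simp add: add_ac dbl')
    from dvd_add[OF g[of ?x ?z] this] show ?thesis by (simp add: num add_ac)
  qed
  have 2: "(?y + ?z) dvd phi_num f"
  proof -
    have "(?y + ?z) dvd (g ?x + g (?x + ?y + ?z))"
      using g[of ?x "?x + ?y + ?z"] by (simp add: add_ac dbl')
    from dvd_add[OF g[of ?y ?z] this] show ?thesis by (simp add: num add_ac)
  qed
  have 3: "(?x + ?y) dvd phi_num f"
  proof -
    have "?z + (?x + ?y + ?z) = ?x + ?y"
      using dbl'[of ?z "?x + ?y"] by (simp only: add_ac)
    then have "(?x + ?y) dvd (g ?z + g (?x + ?y + ?z))"
      using g[of ?z "?x + ?y + ?z"] by (simp only:)
    from dvd_add[OF g[of ?x ?y] this] show ?thesis by (simp add: num add_ac)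
  qed
  have ch2: "CHAR('a poly poly) = 2" and ch1: "CHAR('a poly) = 2" using assms by simp_all
  define u v where "u = ([:[:0, 1:]:] :: 'a poly poly)" and "v = ([:0, 1:] :: 'a poly poly)"
  have xz: "?x + ?z = [:u, 1:]" and yz: "?y + ?z = [:v, 1:]" and xy: "?x + ?y = [:u + v:]"
    by (simp_all add: var_x_def var_y_def var_z_def u_def v_def)
  have root: "[:c, 1:] dvd p \<longleftrightarrow> poly p c = 0" for c and p :: "'a poly3"
    using poly_eq_0_iff_dvd[of p c] by (simp add: uminus_CHAR_2[OF ch2])
  have uv: "u + v = [:[:0, 1:], 1:]" by (simp add: u_def v_def)
  have root1: "[:c, 1:] dvd p \<longleftrightarrow> poly p c = 0" for c and p :: "'a poly poly"
    using poly_eq_0_iff_dvd[of p c] by (simp add: uminus_CHAR_2[OF ch1])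
  have pr: "prime_elem (u + v)"
    unfolding uv by (rule prime_elemI) (auto simp: root1 is_unit_poly_iff)
  then have pr3: "prime_elem (?x + ?y)" unfolding xy by (rule lift_prime_elem_poly)
  have uv0: "u + v \<noteq> 0" by (simp add: uv)
  have nu: "\<not> (u + v) dvd 1" using pr by (rule prime_elem_not_unit)
  have nd: "\<not> (?x + ?y) dvd [:c, 1:]" for c
  proof
    assume "(?x + ?y) dvd [:c, 1:]"
    then have "(u + v) dvd coeff [:c, 1:] 1" unfolding xy const_poly_dvd_iff by blast
    with nu show False by simp
  qed
  from 1 obtain Q where Q: "phi_num f = [:u, 1:] * Q" unfolding xz by (elim dvdE)
  from 2 have "poly Q v = 0"
    unfolding yz root Q using uv0 by (simp add: distrib_right[symmetric])
  then obtain R where R: "Q = [:v, 1:] * R" unfolding root[symmetric] by (elim dvdE)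
  have "(?x + ?y) dvd [:u, 1:] * ([:v, 1:] * R)" using 3 Q R by simp
  then have "(?x + ?y) dvd R"
    using nd by (simp only: prime_elem_dvd_mult_iff[OF pr3] simp_thms)
  then obtain S where "R = (?x + ?y) * S" by (elim dvdE)
  then have "phi_num f = phi_den * S"
    unfolding Q R phi_den_def xz yz by (simp only: mult_ac)
  then show ?thesis by simp
qed

lemma phi_mult_den:
  fixes f :: "'a::field poly"
  assumes "CHAR('a) = 2"
  shows "phi f * phi_den = phi_num f"
  using phi_den_dvd_num[OF assms] by (simp add: phi_def)

lemma alg_closure_char_2:
  fixes y :: "'a::field alg_closure"
  assumes fin: "finite (UNIV :: 'a set)" and ch: "CHAR('a) = 2"
  shows "\<exists>m>0. y ^ (2 ^ m) = y"
proof -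
  obtain p :: "'a poly" where p: "p \<noteq> 0" "poly (map_poly to_ac p) y = 0"
    using alg_closure_algebraic .
  define ev where "ev q = poly (map_poly to_ac q) y" for q :: "'a poly"
  have ev_pCons [simp]: "ev (pCons a q) = to_ac a + y * ev q" for a q
    by (simp add: ev_def map_poly_pCons)
  have ev_0 [simp]: "ev 0 = 0" by (simp add: ev_def)
  have ev_add: "ev (q + r) = ev q + ev r" for q r
    by (induction q r rule: poly_induct2) (simp_all add: algebra_simps)
  have ev_smult: "ev (smult a r) = to_ac a * ev r" for a r
    by (induction r) (simp_all add: algebra_simps)
  have ev_mult: "ev (q * r) = ev q * ev r" for q r
    by (induction q) (simp_all add: ev_add ev_smult algebra_simps)
  have ev_p: "ev p = 0" using p by (simp add: ev_def)
  have ev_mod: "ev (q mod p) = ev q" for q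
  proof -
    have "ev q = ev (q div p * p + q mod p)" by simp
    also have "\<dots> = ev (q mod p)" by (simp only: ev_add ev_mult ev_p) simp
    finally show ?thesis ..
  qed
  define P where "P = {q :: 'a poly. length (coeffs q) \<le> Suc (Polynomial.degree p)}"
  have "coeffs ` P \<subseteq> {xs. set xs \<subseteq> UNIV \<and> length xs \<le> Suc (Polynomial.degree p)}"
    by (auto simp: P_def)
  then have "finite (coeffs ` P)"
    using finite_lists_length_le[OF fin] finite_subset by blast
  then have "finite P"
    by (rule finite_imageD) (auto simp: inj_on_def coeffs_eq_iff)
  moreover have "q mod p \<in> P" for q
    using degree_mod_less[OF p(1), of q]
    by (cases "q mod p = 0") (auto simp: P_def length_coeffs_degree)
  then have "range ev \<subseteq> ev ` P" by (metis ev_mod image_eqI image_subsetI)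
  ultimately have fin_ev: "finite (range ev)" using finite_surj by blast
  have "ev (Polynomial.monom 1 j) = y ^ j" for j
    by (simp add: ev_def map_poly_monom poly_monom)
  then have "range (\<lambda>i::nat. y ^ (2 ^ i)) \<subseteq> range ev"
    by (metis image_subsetI rangeI)
  then have "finite (range (\<lambda>i::nat. y ^ (2 ^ i)))" using fin_ev finite_subset by blast
  then have "\<not> inj (\<lambda>i::nat. y ^ (2 ^ i))" using finite_imageD infinite_UNIV_nat by blast
  then obtain i j :: nat where "i < j" "y ^ (2 ^ i) = y ^ (2 ^ j)"
    unfolding inj_on_def by (metis linorder_neqE_nat)
  moreover define m where "m = j - i"
  ultimately have m: "m > 0" "y ^ (2 ^ i) = (y ^ (2 ^ m)) ^ (2 ^ i)"
    by (simp_all add: power_mult[symmetric] power_add[symmetric])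
  have c2: "CHAR('a alg_closure) = 2" using ch by simp
  have sq: "a = b" if "a ^ 2 = b ^ 2" for a b :: "'a alg_closure"
    using that uminus_CHAR_2[OF c2, of b] by (auto simp: power2_eq_iff)
  have "a = b" if "a ^ (2 ^ i) = b ^ (2 ^ i)" for a b :: "'a alg_closure"
    using that
  proof (induction i)
    case (Suc i)
    then have "(a ^ (2 ^ i)) ^ 2 = (b ^ (2 ^ i)) ^ 2"
      by (simp add: power_mult[symmetric] mult.commute)
    then show ?case using sq Suc.IH by blast
  qed simp
  from this[OF m(2)] m(1) show ?thesis by metis
qed

end

theory Submission
  imports Defs
begin

text \<open>
  Let \<open>q = 2^k\<close>, so that the exponent is \<open>K = q^2 - q + 1\<close> and \<open>(q + 1) K = q^3 + 1\<close>. Work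
  over the algebraic closure. For each exponent \<open>j\<close> let \<open>N_j = x^j + y^j + z^j + (x + y + z)^j\<close>,
  and let \<open>\<phi>_j\<close>, homogeneous of degree \<open>j - 3\<close>, be its quotient by
  \<open>(x + y) (x + z) (y + z)\<close>. Then \<open>\<phi>\<close> has leading form \<open>\<phi>_K\<close> and, below it, nothing until
  \<open>c \<phi>_d\<close>, where \<open>d\<close> is the degree of \<open>h\<close> and \<open>c \<noteq> 0\<close> its leading coefficient.

  The plane curve \<open>\<phi>_K = 0\<close> is a union of rational curves. For \<open>a\<close> in the field with \<open>q\<close>
  elements, other than 0 and 1, the norm of \<open>a + (a + 1) \<nu>\<close>, namely its \<open>(q + 1)\<close>-st power, gives
  the curve \<open>\<nu> \<mapsto> ((a + (a + 1) \<nu>)^(q+1), \<nu>^(q+1), 1)\<close> (\<open>kasami_on_curve\<close>). It passes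
  through \<open>(a^2, 0, 1)\<close> at \<open>\<nu> = 0\<close> and, whatever \<open>a\<close> is, through \<open>(1, 1, 1)\<close> at \<open>\<nu> = 1\<close>.
  Two facts show that every nonconstant factor of \<open>\<phi>_K\<close> vanishes on one of these curves: all zeros of
  \<open>\<phi>_K\<close> on the line \<open>y = 0\<close> are, projectively, points \<open>(a^2, 0, 1)\<close> (\<open>zero_on_line_y_0\<close>), and \<open>\<phi>_K\<close> is
  smooth there, so that the cofactor does not vanish at that point (\<open>cofactors_not_both_zero\<close>).

  Now let \<open>\<phi> = A B\<close> with \<open>A\<close> and \<open>B\<close> of total degrees \<open>S, U > 0\<close>, so \<open>S + U = K - 3\<close>. On
  the cone over a curve on which the leading form of \<open>A\<close> vanishes, parametrized by \<open>T\<close> times the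
  curve, \<open>\<phi>\<close> has degree at most \<open>d - 3\<close> in \<open>T\<close>, while \<open>B\<close> keeps its full degree \<open>U\<close>. Hence
  \<open>A\<close> has degree at most \<open>d - 3 - U\<close> there, and this survives specialization to the common point
  \<open>(1, 1, 1)\<close> (\<open>degree_on_diagonal\<close>). In the same way \<open>B (T, T, T)\<close> has degree at most
  \<open>d - 3 - S\<close>, so \<open>\<phi> (T, T, T)\<close> has degree at most \<open>2 (d - 3) - (K - 3) < d - 3\<close>. But its
  coefficient at \<open>T^(d - 3)\<close> is \<open>c \<phi>_d (1, 1, 1) = c\<close>, because \<open>d\<close> is 3 modulo 4
  (\<open>eval_at_1_1_1_coeff_dilate\<close>), a contradiction.
\<close>

section \<open>Evaluation homomorphisms on iterated polynomial rings\<close>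

locale rhom =
  fixes f :: "'a::comm_ring_1 \<Rightarrow> 'b::comm_ring_1"
  assumes add: "f (x + y) = f x + f y"
    and mult: "f (x * y) = f x * f y"
    and one: "f 1 = 1"
begin

lemma zero: "f 0 = 0"
  using add[of 0 0] by simp

lemma power: "f (x ^ n) = f x ^ n"
  by (induction n) (simp_all add: one mult)

end

definition ev :: "('a::comm_ring_1 \<Rightarrow> 'b::comm_ring_1) \<Rightarrow> 'b \<Rightarrow> 'a poly \<Rightarrow> 'b" where
  "ev f a p = poly (map_poly f p) a"

lemma ev_0 [simp]: "ev f a 0 = 0"
  by (simp add: ev_def)

lemma ev_pCons:
  assumes "rhom f"
  shows "ev f a (pCons c p) = f c + a * ev f a p"
  by (simp add: ev_def map_poly_pCons rhom.zero[OF assms])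

lemma rhom_ev:
  assumes "rhom f"
  shows "rhom (ev f a)"
proof -
  interpret f: rhom f by fact
  note step = ev_pCons[OF assms]
  have add: "ev f a (p + q) = ev f a p + ev f a q" for p q
    by (induction p q rule: poly_induct2) (simp_all add: step f.add f.zero algebra_simps)
  have smult: "ev f a (smult c p) = f c * ev f a p" for c p
    by (induction p) (simp_all add: step f.mult algebra_simps)
  have mult: "ev f a (p * q) = ev f a p * ev f a q" for p q
    by (induction p) (simp_all add: step add smult f.zero algebra_simps)
  have "ev f a 1 = 1"
    by (simp add: one_pCons step f.one)
  with add mult show ?thesis
    by unfold_locales
qed

lemma rhom_comp: "rhom f \<Longrightarrow> rhom g \<Longrightarrow> rhom (\<lambda>x. g (f x))"
  by (simp add: rhom_def)

lemma rhom_id: "rhom (\<lambda>x. x)"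
  by (simp add: rhom_def)

lemma rhom_const: "rhom (\<lambda>c. [:c:])"
  by unfold_locales (simp_all add: one_pCons)

lemma rhom_const3: "rhom const3"
  by unfold_locales (simp_all add: const3_def one_pCons)

lemma rhom_poly: "rhom (\<lambda>p. poly p a)"
  by unfold_locales simp_all

lemma map_poly_eq_ev:
  assumes "rhom f"
  shows "map_poly f p = ev (\<lambda>c. [:f c:]) [:0, 1:] p"
  by (induction p)
    (simp_all add: ev_pCons[OF rhom_comp[OF assms rhom_const]] map_poly_pCons rhom.zero[OF assms])

lemma rhom_map_poly:
  assumes "rhom f"
  shows "rhom (map_poly f)"
proof -
  have "map_poly f = ev (\<lambda>c. [:f c:]) [:0, 1:]"
    using map_poly_eq_ev[OF assms] by blast
  then show ?thesis
    using rhom_ev[OF rhom_comp[OF assms rhom_const]] by simp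
qed

lemma hom_ev:
  assumes f: "rhom f" and g: "rhom g"
  shows "g (ev f a p) = ev (\<lambda>c. g (f c)) (g a) p"
  by (induction p)
    (simp_all add: ev_pCons[OF f] ev_pCons[OF rhom_comp[OF f g]]
      rhom.zero[OF g] rhom.add[OF g] rhom.mult[OF g])

lemma ev_map_poly:
  assumes f: "rhom f" and g: "rhom g"
  shows "ev g a (map_poly f p) = ev (\<lambda>c. g (f c)) a p"
  by (induction p)
    (simp_all add: map_poly_pCons rhom.zero[OF f] ev_pCons[OF g] ev_pCons[OF rhom_comp[OF f g]])

lemma coeff_ev_dilate:
  assumes "rhom g"
  shows "Polynomial.coeff (ev (\<lambda>c. [:g c:]) [:0, u:] p) j = g (Polynomial.coeff p j) * u ^ j"
proof (induction p arbitrary: j)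
  case 0
  then show ?case by (simp add: rhom.zero[OF assms])
next
  case (pCons c p)
  show ?case
    by (cases j) (simp_all add: ev_pCons[OF rhom_comp[OF assms rhom_const]] pCons)
qed

text \<open>
  Substitution of three ring elements for the variables. All specializations below (to points, to
  curves, to cones) are instances, and \<open>hom_ev3\<close> composes them.
\<close>
definition ev3 :: "('a::comm_ring_1 \<Rightarrow> 'b::comm_ring_1) \<Rightarrow> 'b \<Rightarrow> 'b \<Rightarrow> 'b \<Rightarrow> 'a poly3 \<Rightarrow> 'b" where
  "ev3 f a b c = ev (ev (ev f a) b) c"

lemma rhom_ev3: "rhom f \<Longrightarrow> rhom (ev3 f a b c)"
  unfolding ev3_def by (intro rhom_ev)

lemma hom_ev3:
  assumes f: "rhom f" and g: "rhom g"
  shows "g (ev3 f a b c p) = ev3 (\<lambda>u. g (f u)) (g a) (g b) (g c) p"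
proof -
  have 1: "(\<lambda>u. g (ev f a u)) = ev (\<lambda>u. g (f u)) (g a)"
    by (rule ext) (rule hom_ev[OF f g])
  have 2: "(\<lambda>u. g (ev (ev f a) b u)) = ev (ev (\<lambda>u. g (f u)) (g a)) (g b)"
    by (rule ext) (simp only: hom_ev[OF rhom_ev[OF f] g] 1)
  show ?thesis
    by (simp only: ev3_def hom_ev[OF rhom_ev[OF rhom_ev[OF f]] g] 2)
qed

lemma ev3_simps:
  assumes f: "rhom f"
  shows "ev3 f a b c var_x = a" "ev3 f a b c var_y = b" "ev3 f a b c var_z = c"
    "ev3 f a b c (const3 u) = f u"
proof -
  note s = rhom.zero rhom.one rhom_ev ev_pCons f
  show "ev3 f a b c var_x = a" "ev3 f a b c var_y = b" "ev3 f a b c var_z = c"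
    "ev3 f a b c (const3 u) = f u"
    by (simp_all add: ev3_def var_x_def var_y_def var_z_def const3_def s)
qed

lemma ev3_vars: "ev3 const3 var_x var_y var_z p = p"
proof -
  have 1: "ev const3 var_x u = [:[:u:]:]" for u :: "'a poly"
  proof (induction u)
    case (pCons a u)
    then show ?case
      by (simp only: ev_pCons[OF rhom_const3] pCons) (simp add: const3_def var_x_def)
  qed simp
  have 2: "ev (ev const3 var_x) var_y u = [:u:]" for u :: "'a poly poly"
  proof (induction u)
    case (pCons a u)
    then show ?case
      by (simp only: ev_pCons[OF rhom_ev[OF rhom_const3]] pCons) (simp add: 1 var_y_def)
  qed simp
  show ?thesis
    unfolding ev3_def
  proof (induction p)
    case (pCons a p)
    then show ?case
      by (simp only: ev_pCons[OF rhom_ev[OF rhom_ev[OF rhom_const3]]] pCons)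
        (simp add: 2 var_z_def)
  qed simp
qed

lemma hom_subst3:
  assumes "rhom f"
  shows "ev3 f a b c (subst3 p u) = ev f (ev3 f a b c u) p"
  using hom_ev[OF rhom_const3 rhom_ev3[OF assms]]
  by (simp add: subst3_def ev_def[symmetric] ev3_simps[OF assms])

section \<open>Dilation and total degree\<close>

text \<open>
  The polynomial \<open>p (T x, T y, T z)\<close> in a new outermost variable \<open>T\<close>. Its coefficient at
  \<open>T^i\<close> is the homogeneous part of \<open>p\<close> of degree \<open>i\<close>, so its degree is the total degree of
  \<open>p\<close> and its leading coefficient is the leading form. Over a domain, total degrees
  add and leading forms multiply because this map is a homomorphism into a polynomial ring.
\<close>
definition dilate :: "'a::comm_ring_1 poly3 \<Rightarrow> 'a poly3 poly" where
  "dilate = ev3 (\<lambda>c. [:const3 c:]) [:0, var_x:] [:0, var_y:] [:0, var_z:]"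

definition four_power_sum :: "'a::comm_ring_1 \<Rightarrow> 'a \<Rightarrow> 'a \<Rightarrow> nat \<Rightarrow> 'a" where
  "four_power_sum x y z j = x ^ j + y ^ j + z ^ j + (x + y + z) ^ j"

lemma rhom_const_const3: "rhom (\<lambda>c. [:const3 c:])"
  by (rule rhom_comp[OF rhom_const3 rhom_const])

lemma rhom_dilate: "rhom dilate"
  unfolding dilate_def by (rule rhom_ev3[OF rhom_const_const3])

lemma coeff_dilate_num:
  "Polynomial.coeff (dilate (phi_num f)) j
     = const3 (Polynomial.coeff f j) * four_power_sum var_x var_y var_z j"
proof -
  interpret d: rhom dilate by (rule rhom_dilate)
  note hs = hom_subst3[OF rhom_const_const3, of "[:0, var_x:]" "[:0, var_y:]" "[:0, var_z:]",
      folded dilate_def]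
  note vs = ev3_simps[OF rhom_const_const3, of "[:0, var_x:]" "[:0, var_y:]" "[:0, var_z:]",
      folded dilate_def]
  have "dilate (phi_num f) = ev (\<lambda>c. [:const3 c:]) [:0, var_x:] f
      + ev (\<lambda>c. [:const3 c:]) [:0, var_y:] f + ev (\<lambda>c. [:const3 c:]) [:0, var_z:] f
      + ev (\<lambda>c. [:const3 c:]) [:0, var_x + var_y + var_z:] f"
    by (simp only: phi_num_def d.add hs vs add_pCons add_0)
  then show ?thesis
    by (simp only: coeff_add coeff_ev_dilate[OF rhom_const3] four_power_sum_def distrib_left)
qed

lemma dilate_den: "dilate phi_den = Polynomial.monom phi_den 3"
proof -
  interpret d: rhom dilate by (rule rhom_dilate)
  note vs = ev3_simps[OF rhom_const_const3, of "[:0, var_x:]" "[:0, var_y:]" "[:0, var_z:]",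
      folded dilate_def]
  have m: "[:0, a:] = Polynomial.monom a 1" for a :: "'a poly3"
    by (simp add: monom_Suc monom_0)
  show ?thesis
    by (simp add: phi_den_def d.add d.mult vs m add_monom mult_monom numeral_3_eq_3)
qed

text \<open>
  The homogeneous parts of the quotient are the multiples of the quotients belonging to single
  powers; multiplying by the denominator avoids having to divide.
\<close>
lemma coeff_dilate_quotient:
  assumes "\<Phi> * phi_den = phi_num f"
  shows "Polynomial.coeff (dilate \<Phi>) j * phi_den
     = const3 (Polynomial.coeff f (j + 3)) * four_power_sum var_x var_y var_z (j + 3)"
proof -
  have "Polynomial.monom phi_den 3 * dilate \<Phi> = dilate (phi_num f)"
    using assms by (metis dilate_den rhom.mult rhom_dilate mult.commute)
  from arg_cong[OF this, of "\<lambda>p. Polynomial.coeff p (j + 3)"] show ?thesis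
    by (simp add: coeff_dilate_num coeff_monom_mult mult.commute[of phi_den])
qed

lemma map_poly_dilate:
  assumes "rhom \<sigma>"
  shows "map_poly \<sigma> (dilate p)
     = ev3 (\<lambda>c. [:\<sigma> (const3 c):]) [:0, \<sigma> var_x:] [:0, \<sigma> var_y:] [:0, \<sigma> var_z:] p"
  unfolding dilate_def
  using hom_ev3[OF rhom_const_const3 rhom_map_poly[OF assms]]
  by (simp add: map_poly_pCons rhom.zero[OF assms])

lemma poly_dilate: "poly (dilate p) t = ev3 const3 (t * var_x) (t * var_y) (t * var_z) p"
  by (simp add: dilate_def hom_ev3[OF rhom_const_const3 rhom_poly[of t]])

text \<open>If \<open>p (T x, T y, T z)\<close> is free of \<open>T\<close>, compare its values at \<open>T = 1\<close> and \<open>T = 0\<close>.\<close>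
lemma is_unit_if_dilate_const:
  fixes p :: "'a::field poly3"
  assumes "Polynomial.degree (dilate p) = 0" and "p \<noteq> 0"
  shows "p dvd 1"
proof -
  have "poly (dilate p) 1 = poly (dilate p) 0"
    using assms(1) by (metis degree_eq_zeroE poly_const_conv)
  then have "p = ev3 const3 0 0 0 p"
    by (simp add: poly_dilate ev3_vars)
  also have "\<dots> = const3 (ev3 (\<lambda>c. c) 0 0 0 p)"
    using hom_ev3[OF rhom_id rhom_const3, of 0 0 0 p] by (simp add: rhom.zero[OF rhom_const3])
  finally obtain c where c: "p = const3 c" by blast
  then have "c \<noteq> 0" using assms(2) by (auto simp: const3_def)
  then have "p * const3 (inverse c) = 1"
    unfolding c using rhom.mult[OF rhom_const3, of c "inverse c"]
    by (simp add: rhom.one[OF rhom_const3])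
  then show ?thesis by (metis dvd_triv_left)
qed

lemma dilate_eq_0_iff: "dilate p = 0 \<longleftrightarrow> p = 0"
proof
  assume "dilate p = 0"
  then have "poly (dilate p) 1 = 0" by simp
  then show "p = 0" by (simp add: poly_dilate ev3_vars)
qed (simp add: rhom.zero[OF rhom_dilate])

abbreviation eval_at :: "'a::comm_ring_1 \<Rightarrow> 'a \<Rightarrow> 'a \<Rightarrow> 'a poly3 \<Rightarrow> 'a" where
  "eval_at \<equiv> ev3 (\<lambda>c. c)"

abbreviation eval_along :: "'a::comm_ring_1 poly \<Rightarrow> 'a poly \<Rightarrow> 'a poly \<Rightarrow> 'a poly3 \<Rightarrow> 'a poly" where
  "eval_along \<equiv> ev3 (\<lambda>c. [:c:])"

lemmas rhom_eval_at = rhom_ev3[OF rhom_id]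
lemmas rhom_eval_along = rhom_ev3[OF rhom_const]

lemma poly_eval_along: "poly (eval_along a b c p) t = eval_at (poly a t) (poly b t) (poly c t) p"
  using hom_ev3[OF rhom_const rhom_poly] by simp

lemma hom_four_power_sum:
  assumes "rhom \<sigma>"
  shows "\<sigma> (four_power_sum x y z j) = four_power_sum (\<sigma> x) (\<sigma> y) (\<sigma> z) j"
  by (simp add: four_power_sum_def rhom.add[OF assms] rhom.power[OF assms])

lemma hom_den:
  assumes "rhom f"
  shows "ev3 f a b c phi_den = (a + b) * (a + c) * (b + c)"
  by (simp add: phi_den_def rhom.add[OF rhom_ev3[OF assms]] rhom.mult[OF rhom_ev3[OF assms]]
      ev3_simps[OF assms])

text \<open>
  This condition on polynomials in \<open>\<xi>\<close> and \<open>T\<close>, with \<open>T\<close> outermost, describes a subring that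
  contains \<open>\<xi> T\<close> and \<open>T\<close>, and hence every \<open>p (\<xi> T, 0, T)\<close>. It serves to show that a form of
  degree \<open>i\<close> restricts to a polynomial of degree at most \<open>i\<close> on the line \<open>y = 0\<close>.
\<close>
definition graded :: "'a::comm_ring_1 poly poly \<Rightarrow> bool" where
  "graded p \<longleftrightarrow> (\<forall>i. Polynomial.degree (Polynomial.coeff p i) \<le> i)"

lemma graded_add: "graded p \<Longrightarrow> graded q \<Longrightarrow> graded (p + q)"
  by (simp add: graded_def degree_add_le)

lemma graded_mult:
  assumes "graded p" "graded q"
  shows "graded (p * q)"
proof -
  have "Polynomial.degree (Polynomial.coeff p j * Polynomial.coeff q (i - j)) \<le> i"
    if "j \<le> i" for i j
  proof -
    have "Polynomial.degree (Polynomial.coeff p j * Polynomial.coeff q (i - j))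
        \<le> Polynomial.degree (Polynomial.coeff p j) + Polynomial.degree (Polynomial.coeff q (i - j))"
      by (rule degree_mult_le)
    also have "\<dots> \<le> j + (i - j)"
      using assms unfolding graded_def by (intro add_mono) auto
    finally show ?thesis using that by simp
  qed
  then show ?thesis
    unfolding graded_def coeff_mult by (intro allI degree_sum_le) auto
qed

lemma graded_ev:
  assumes "rhom f" "\<And>c. graded (f c)" "graded a"
  shows "graded (ev f a p)"
proof (induction p)
  case 0
  then show ?case by (simp add: graded_def)
next
  case (pCons c p)
  then show ?case
    by (simp add: ev_pCons[OF assms(1)] graded_add graded_mult assms)
qed

lemma degree_eval_along_line_coeff_dilate:
  "Polynomial.degree (eval_along [:0, 1:] 0 1 (Polynomial.coeff (dilate p) i)) \<le> i"
proof -
  let ?\<sigma> = "eval_along [:0, 1:] 0 (1 :: 'a poly)"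
  have s: "rhom ?\<sigma>" by (rule rhom_eval_along)
  have c: "rhom (\<lambda>c::'a. [:[:c:]:])" by (rule rhom_comp[OF rhom_const rhom_const])
  have "graded (ev3 (\<lambda>c::'a. [:[:c:]:]) [:0, [:0, 1:]:] [:0, 0:] [:0, 1:] p)"
    unfolding ev3_def
    by (intro graded_ev rhom_ev[OF c] rhom_ev[OF rhom_ev[OF c]] c)
      (auto simp: graded_def coeff_pCons split: nat.splits)
  also have "ev3 (\<lambda>c::'a. [:[:c:]:]) [:0, [:0, 1:]:] [:0, 0:] [:0, 1:] p = map_poly ?\<sigma> (dilate p)"
    by (simp add: map_poly_dilate[OF s] ev3_simps[OF rhom_const])
  finally show ?thesis
    by (simp add: graded_def coeff_map_poly rhom.zero[OF s])
qed

section \<open>The Kasami form in characteristic two\<close>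

lemma two_eq_0: "CHAR('a::comm_ring_1) = 2 \<Longrightarrow> (2::'a) = 0"
  using of_nat_CHAR[where ?'a = 'a] by simp

lemma frobenius_add:
  fixes x y :: "'a::comm_ring_1"
  assumes "CHAR('a) = 2"
  shows "(x + y) ^ (2 ^ m) = x ^ (2 ^ m) + y ^ (2 ^ m)"
  using freshmans_dream'[of "2 ^ m" m x y] assms by simp

text \<open>
  The line \<open>(u, v) \<mapsto> (c u + (c + 1) v, v, u, (c + 1) u + c v)\<close> lies on the Hermitian surface
  \<open>X^(r+1) + Y^(r+1) + Z^(r+1) + W^(r+1) = 0\<close>. As \<open>c\<close> is fixed by the \<open>r\<close>-th power map, each
  \<open>(r + 1)\<close>-st power on the left is a linear form times its conjugate.
\<close>
lemma norm_sum:
  fixes c u v :: "'a::comm_ring_1"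
  assumes ch: "CHAR('a) = 2" and r: "r = 2 ^ m" and c: "c ^ r = c"
  shows "(c * u + (c + 1) * v) ^ (r + 1) + ((c + 1) * u + c * v) ^ (r + 1)
     = u ^ (r + 1) + v ^ (r + 1)"
proof -
  have c1: "(c + 1) ^ r = c + 1"
    using frobenius_add[OF ch, of c 1 m] c by (simp add: r)
  have L: "(c * u + (c + 1) * v) ^ r = c * u ^ r + (c + 1) * v ^ r"
    and M: "((c + 1) * u + c * v) ^ r = (c + 1) * u ^ r + c * v ^ r"
    using frobenius_add[OF ch, of "c * u" "(c + 1) * v" m] frobenius_add[OF ch, of "(c + 1) * u" "c * v" m]
      c c1 by (simp_all add: r power_mult_distrib)
  have "(c * u + (c + 1) * v) * (c * u ^ r + (c + 1) * v ^ r)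
      + ((c + 1) * u + c * v) * ((c + 1) * u ^ r + c * v ^ r)
    = u * u ^ r + v * v ^ r
      + 2 * ((c * c + c) * (u * u ^ r + v * v ^ r + u * v ^ r + v * u ^ r))"
    by (simp add: algebra_simps)
  then show ?thesis
    by (simp add: L M two_eq_0[OF ch])
qed

lemma square_inj_char_2:
  fixes a b :: "'a::idom"
  assumes "CHAR('a) = 2" "a ^ 2 = b ^ 2"
  shows "a = b"
  using assms(2) uminus_CHAR_2[OF assms(1), of b] by (auto simp: power2_eq_iff)

lemma poly_pderiv_double_root:
  assumes "poly a x = 0" "poly b x = 0"
  shows "poly (pderiv (a * b)) x = 0"
  by (simp add: pderiv_mult assms)

locale kasami =
  fixes k q K :: nat
  assumes k: "k > 0" and q: "q = 2 ^ k" and K: "K + q = q * q + 1"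
begin

lemma q_gt_1: "q > 1"
  using one_less_power[of "2::nat" k] k by (simp add: q)

lemma odd_K: "odd K"
proof -
  have "even q" using k by (simp add: q)
  then have "odd (K + q)" unfolding K by simp
  with \<open>even q\<close> show ?thesis by simp
qed

lemma K_ge_3: "K \<ge> 3"
proof -
  have "q * q \<ge> 2 * q" using q_gt_1 by (intro mult_right_mono) auto
  then show ?thesis using K q_gt_1 by linarith
qed

lemma of_nat_K:
  assumes "CHAR('a::comm_ring_1) = 2"
  shows "of_nat K = (1::'a)"
proof -
  obtain m where "K = 2 * m + 1" using odd_K by (elim oddE)
  then show ?thesis by (simp add: two_eq_0[OF assms])
qed

text \<open>
  On the line \<open>y = 0\<close> all powers can be expressed through \<open>x\<close>, \<open>x^q\<close> and \<open>x^(q^2)\<close>, since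
  \<open>K + q = q^2 + 1\<close>. The resulting factorization shows at once that all zeros lie in the field with
  \<open>q\<close> elements, and it gives the degree of the slice.
\<close>
lemma kasami_slice:
  fixes x :: "'a::comm_ring_1"
  assumes ch: "CHAR('a) = 2"
  shows "x ^ q * (x + 1) ^ q * four_power_sum x 0 1 K = (x ^ q + x) ^ (q + 1)"
proof -
  have lift: "y ^ q * y ^ K = (y ^ q) ^ q * y" for y :: 'a
    using arg_cong[OF K, of "\<lambda>e. y ^ e"] by (simp add: power_add power_mult mult_ac)
  define A where "A = x ^ q"
  define B where "B = A ^ q"
  have x1: "(x + 1) ^ q = A + 1" and A1: "(A + 1) ^ q = B + 1" and Ax: "(A + x) ^ q = B + A"
    using frobenius_add[OF ch, of _ _ k] by (simp_all add: A_def B_def q)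
  have "x ^ q * (x + 1) ^ q * four_power_sum x 0 1 K
      = (x + 1) ^ q * (x ^ q * x ^ K) + x ^ q * (x + 1) ^ q + x ^ q * ((x + 1) ^ q * (x + 1) ^ K)"
    using K_ge_3 by (simp add: four_power_sum_def algebra_simps power_0_left)
  also have "\<dots> = (A + 1) * (B * x) + A * (A + 1) + A * ((B + 1) * (x + 1))"
    by (simp only: lift) (simp only: x1 A1 A_def[symmetric] B_def[symmetric])
  also have "\<dots> = (B + A) * (A + x) + 2 * (A * B * x + A)"
    by (simp add: algebra_simps)
  also have "\<dots> = (A + x) ^ (q + 1)"
    by (simp add: Ax two_eq_0[OF ch])
  finally show ?thesis by (simp add: A_def)
qed

text \<open>
  The norm identity for \<open>r = q\<close> says that the fourth argument \<open>X + Y + Z\<close> is again a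
  \<open>(q + 1)\<close>-st power. As \<open>(q + 1) K = q^3 + 1\<close>, the \<open>K\<close>-th powers then add up to zero by the same
  identity for \<open>r = q^3\<close>.
\<close>
lemma kasami_on_curve:
  fixes c v :: "'a::comm_ring_1"
  assumes ch: "CHAR('a) = 2" and c: "c ^ q = c"
  shows "four_power_sum ((c + (c + 1) * v) ^ (q + 1)) (v ^ (q + 1)) 1 K = 0"
proof -
  define L where "L = c + (c + 1) * v"
  define M where "M = (c + 1) + c * v"
  have dbl: "y + y = 0" for y :: 'a
    using two_eq_0[OF ch] by (simp flip: mult_2)
  have s: "L ^ (r + 1) + M ^ (r + 1) = 1 + v ^ (r + 1)" if "r = 2 ^ m" "c ^ r = c" for r m
    using norm_sum[OF ch that, of 1 v] by (simp add: L_def M_def)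
  have w: "L ^ (q + 1) + v ^ (q + 1) + 1 = M ^ (q + 1)"
  proof -
    have "L ^ (q + 1) + v ^ (q + 1) + 1 = L ^ (q + 1) + (L ^ (q + 1) + M ^ (q + 1))"
      unfolding s[OF q c] by (simp add: add_ac)
    also have "\<dots> = M ^ (q + 1)"
      unfolding add.assoc[symmetric] dbl by simp
    finally show ?thesis .
  qed
  define r where "r = q * q * q"
  have r: "r = 2 ^ (k + k + k)" by (simp add: r_def q power_add)
  have cr: "c ^ r = c" by (simp add: r_def power_mult c)
  have "(q + 1) * K + q * (q + 1) = (q + 1) * (q * q + 1)"
    unfolding K[symmetric] by (simp add: algebra_simps)
  then have e: "(q + 1) * K = r + 1"
    by (simp add: r_def algebra_simps)
  have "four_power_sum (L ^ (q + 1)) (v ^ (q + 1)) 1 K = L ^ (r + 1) + v ^ (r + 1) + 1 + M ^ (r + 1)"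
    by (simp only: four_power_sum_def w power_mult[symmetric] e power_one)
  also have "\<dots> = (L ^ (r + 1) + M ^ (r + 1)) + (1 + v ^ (r + 1))"
    by (simp add: add_ac)
  also have "\<dots> = 0"
    by (simp only: s[OF r cr] dbl)
  finally show ?thesis by (simp add: L_def)
qed

lemma degree_kasami_slice:
  assumes ch: "CHAR('a::field) = 2"
  shows "Polynomial.degree (four_power_sum [:0, 1:] 0 1 K :: 'a poly) + 1 = K"
    and "four_power_sum [:0, 1:] 0 1 K \<noteq> (0 :: 'a poly)"
proof -
  let ?N = "four_power_sum [:0, 1:] 0 1 K :: 'a poly"
  have id: "[:0, 1:] ^ q * [:1, 1:] ^ q * ?N = ([:0, 1:] ^ q + [:0, 1:]) ^ (q + 1)"
    using kasami_slice[of "[:0, 1:] :: 'a poly"] ch by (simp add: one_pCons)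
  have d: "Polynomial.degree ([:0, 1:] ^ q + [:0, 1:] :: 'a poly) = q"
    by (subst degree_add_eq_left) (use q_gt_1 in \<open>simp_all add: degree_power_eq\<close>)
  then have nz: "[:0, 1:] ^ q + [:0, 1:] \<noteq> (0 :: 'a poly)"
    using q_gt_1 by (metis degree_0 not_one_less_zero)
  then show N: "?N \<noteq> 0" using id by auto
  have "Polynomial.degree ([:0, 1:] ^ q * [:1, 1:] ^ q * ?N) = q + q + Polynomial.degree ?N"
    using N by (simp add: degree_mult_eq degree_power_eq)
  moreover have "Polynomial.degree (([:0, 1:] ^ q + [:0, 1:] :: 'a poly) ^ (q + 1)) = (q + 1) * q"
    by (subst degree_power_eq[OF nz]) (simp only: d)
  ultimately have "q + q + Polynomial.degree ?N = (q + 1) * q"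
    unfolding id by simp
  then show "Polynomial.degree ?N + 1 = K"
    using K by simp
qed

text \<open>
  Comparing degrees, neither factor loses degree on the line \<open>y = 0\<close>, so a nonconstant factor has a
  zero there. The points 0 and 1 are excluded because they are simple zeros of the slice which the
  denominator already accounts for; a further zero of \<open>A\<close> would make them double.
\<close>
lemma zero_on_line_y_0:
  fixes A B :: "'a::alg_closed_field poly3"
  assumes ch: "CHAR('a) = 2"
    and fac: "A * B * phi_den = four_power_sum var_x var_y var_z K"
    and degA: "Polynomial.degree (eval_along [:0, 1:] 0 1 A) \<le> S"
    and degB: "Polynomial.degree (eval_along [:0, 1:] 0 1 B) \<le> U"
    and S: "S + U + 3 = K" "S > 0"
  obtains \<alpha> where "\<alpha> ^ q = \<alpha>" "\<alpha> \<noteq> 0" "\<alpha> \<noteq> 1" "eval_at \<alpha> 0 1 A = 0"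
proof -
  interpret \<sigma>: rhom "eval_along [:0, 1:] 0 (1 :: 'a poly)" by (rule rhom_eval_along)
  let ?N = "four_power_sum [:0, 1:] 0 1 K :: 'a poly"
  define a where "a = eval_along [:0, 1:] 0 1 A"
  define b where "b = eval_along [:0, 1:] 0 1 B"
  define e where "e = ([:0, 1, 1:] :: 'a poly)"
  have N: "a * (b * e) = ?N"
  proof -
    have "([:0, 1:] + 0) * ([:0, 1:] + 1) * (0 + 1) = e"
      by (simp add: e_def one_pCons)
    then show ?thesis
      using arg_cong[OF fac, of "eval_along [:0, 1:] 0 1"]
      by (simp only: \<sigma>.mult hom_four_power_sum[OF rhom_eval_along] hom_den[OF rhom_const] ev3_simps[OF rhom_const]
          a_def[symmetric] b_def[symmetric] mult.assoc)
  qed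
  have nz: "a \<noteq> 0" "b \<noteq> 0" "e \<noteq> 0"
    using N degree_kasami_slice(2)[OF ch] by auto
  then have "Polynomial.degree a + Polynomial.degree b + 2 = Polynomial.degree ?N"
    unfolding N[symmetric] by (simp add: degree_mult_eq) (simp add: e_def)
  then have "Polynomial.degree a > 0"
    using degree_kasami_slice(1)[OF ch] S degA degB unfolding a_def b_def by linarith
  then obtain \<alpha> where \<alpha>: "poly a \<alpha> = 0"
    using alg_closed_imp_poly_has_root by blast
  have "poly ?N \<alpha> = 0" unfolding N[symmetric] using \<alpha> by simp
  then have "four_power_sum \<alpha> 0 1 K = 0" using K_ge_3 by (simp add: four_power_sum_def power_0_left)
  then have "(\<alpha> ^ q + \<alpha>) ^ (q + 1) = 0"
    using kasami_slice[OF ch, of \<alpha>] by simp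
  then have "\<alpha> ^ q + \<alpha> = 0" by auto
  then have frob: "\<alpha> ^ q = \<alpha>"
    using uminus_CHAR_2[OF ch] by (simp add: add_eq_0_iff)
  have K1: "K - 1 > 0" using K_ge_3 by simp
  have "pderiv ?N = [:0, 1:] ^ (K - 1) + [:1, 1:] ^ (K - 1)"
    using K_ge_3 of_nat_K[OF ch]
    by (simp add: four_power_sum_def pderiv_add pderiv_power power_0_left one_pCons pderiv_pCons)
  then have D: "poly (pderiv ?N) \<alpha> = \<alpha> ^ (K - 1) + (1 + \<alpha>) ^ (K - 1)"
    by simp
  have "\<not> (\<alpha> = 0 \<or> \<alpha> = 1)"
  proof
    assume c: "\<alpha> = 0 \<or> \<alpha> = 1"
    then have "poly (b * e) \<alpha> = 0"
      by (auto simp: e_def two_eq_0[OF ch])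
    from poly_pderiv_double_root[OF \<alpha> this] have "\<alpha> ^ (K - 1) + (1 + \<alpha>) ^ (K - 1) = 0"
      unfolding N D by simp
    with c K1 show False by (auto simp: two_eq_0[OF ch] power_0_left)
  qed
  moreover have "eval_at \<alpha> 0 1 A = 0"
    using \<alpha> by (simp add: a_def poly_eval_along)
  ultimately show thesis using frob by (intro that) auto
qed

text \<open>
  A common zero of the cofactors would be a double zero of the product along the line
  \<open>\<eta> \<mapsto> (\<alpha>, \<eta>, 1)\<close>, but the derivative of the right-hand side there is
  \<open>(\<alpha> + 1)^(K - 1)\<close>. The direction matters: along the line \<open>y = 0\<close> the zeros have multiplicity
  \<open>q + 1\<close>.
\<close>
lemma cofactors_not_both_zero:
  fixes A B :: "'a::field poly3"
  assumes ch: "CHAR('a) = 2"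
    and fac: "A * B * phi_den = four_power_sum var_x var_y var_z K"
    and \<alpha>: "\<alpha> \<noteq> 1" and A: "eval_at \<alpha> 0 1 A = 0"
  shows "eval_at \<alpha> 0 1 B \<noteq> 0"
proof
  assume B: "eval_at \<alpha> 0 1 B = 0"
  interpret \<sigma>: rhom "eval_along [:\<alpha>:] [:0, 1:] 1" by (rule rhom_eval_along)
  let ?N = "four_power_sum [:\<alpha>:] [:0, 1:] 1 K :: 'a poly"
  define a where "a = eval_along [:\<alpha>:] [:0, 1:] 1 A"
  define b where "b = eval_along [:\<alpha>:] [:0, 1:] 1 (B * phi_den)"
  have N: "a * b = ?N"
    using arg_cong[OF fac, of "eval_along [:\<alpha>:] [:0, 1:] 1"]
    by (simp add: \<sigma>.mult hom_four_power_sum[OF rhom_eval_along] rhom_const ev3_simps a_def b_def mult_ac)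
  have "poly a 0 = 0" "poly b 0 = 0"
    using A B by (simp_all add: a_def b_def poly_eval_along \<sigma>.mult)
  from poly_pderiv_double_root[OF this] have "poly (pderiv ?N) 0 = 0"
    unfolding N .
  moreover have "pderiv ?N = [:0, 1:] ^ (K - 1) + [:\<alpha> + 1, 1:] ^ (K - 1)"
    using K_ge_3 of_nat_K[OF ch]
    by (simp add: four_power_sum_def pderiv_add pderiv_power one_pCons pderiv_pCons)
  ultimately have "(\<alpha> + 1) ^ (K - 1) = 0"
    using K_ge_3 by (simp add: power_0_left)
  then have "\<alpha> + 1 = 0" by simp
  with \<alpha> show False
    by (simp only: add_eq_0_iff2 uminus_CHAR_2[OF ch])
qed

abbreviation curve :: "'a::comm_ring_1 \<Rightarrow> 'a poly3 \<Rightarrow> 'a poly" where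
  "curve a \<equiv> eval_along ([:a, a + 1:] ^ (q + 1)) ([:0, 1:] ^ (q + 1)) 1"

text \<open>
  The product vanishes identically on the curve, and \<open>B\<close> and the denominator are nonzero at its
  point \<open>\<nu> = 0\<close>; so the factor \<open>A\<close> that vanishes at that single point vanishes on all of it.
\<close>
lemma vanishes_on_curve:
  fixes A B :: "'a::field poly3"
  assumes ch: "CHAR('a) = 2"
    and fac: "A * B * phi_den = four_power_sum var_x var_y var_z K"
    and a: "a ^ q = a" "a \<noteq> 0" "a \<noteq> 1"
    and A: "eval_at (a ^ 2) 0 1 A = 0"
  shows "curve a A = 0" and "curve a B \<noteq> 0" and "curve a phi_den \<noteq> 0"
proof -
  interpret \<sigma>: rhom "curve a" by (rule rhom_eval_along)
  have p0: "poly (curve a p) 0 = eval_at (a ^ 2) 0 1 p" for p :: "'a poly3"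
    by (simp add: poly_eval_along power_add[of _ q 1, symmetric] a power2_eq_square)
  have sq: "a ^ 2 \<noteq> 1" using square_inj_char_2[OF ch, of a 1] a by auto
  then have "eval_at (a ^ 2) 0 1 B \<noteq> 0" using cofactors_not_both_zero[OF ch fac _ A] by blast
  then show B: "curve a B \<noteq> 0" using p0[of B] by auto
  have "a ^ 2 + 1 \<noteq> 0"
    using sq by (simp only: add_eq_0_iff2 uminus_CHAR_2[OF ch] not_False_eq_True)
  then have "eval_at (a ^ 2) 0 1 phi_den \<noteq> 0"
    using a by (simp add: hom_den rhom_id)
  then show den: "curve a phi_den \<noteq> 0" using p0[of phi_den] by auto
  have "[:a, a + 1:] = [:a:] + ([:a:] + 1) * [:0, 1:]"
    by (simp add: one_pCons)
  moreover have "[:a:] ^ q = [:a:]"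
    using a by (simp add: poly_const_pow)
  ultimately have "four_power_sum ([:a, a + 1:] ^ (q + 1)) ([:0, 1:] ^ (q + 1)) 1 K = 0"
    using kasami_on_curve[of "[:a:]" "[:0, 1:]"] ch by simp
  then have "curve a (A * B * phi_den) = 0"
    unfolding fac by (simp only: hom_four_power_sum[OF rhom_eval_along] ev3_simps[OF rhom_const])
  then have "curve a A * curve a B * curve a phi_den = 0"
    by (simp only: \<sigma>.mult)
  then show "curve a A = 0"
    using B den by (simp only: mult_eq_0_iff) blast
qed

end

section \<open>The value at (1,1,1) for exponents congruent to 3 modulo 4\<close>

lemma power_diff_cube_dvd:
  fixes u :: "'a::field poly"
  assumes ch: "CHAR('a) = 2" and u: "[:0, 1:] dvd u - 1"
  shows "[:0, 1:] ^ 4 dvd u ^ (4 * m + 3) - u ^ 3"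
proof -
  have "u ^ 4 - 1 = (u - 1) ^ 4"
    using frobenius_add[of "u - 1" 1 2] ch by simp
  then have "[:0, 1:] ^ 4 dvd u ^ 4 - 1"
    using u by (simp add: dvd_power_same)
  also have "u ^ 4 - 1 dvd (u ^ 4) ^ m - 1"
    using power_diff_sumr2[of "u ^ 4" m 1] by simp
  also have "(u ^ 4) ^ m - 1 dvd u ^ (4 * m + 3) - u ^ 3"
  proof (rule dvdI)
    show "u ^ (4 * m + 3) - u ^ 3 = ((u ^ 4) ^ m - 1) * u ^ 3"
      by (simp add: power_add power_mult left_diff_distrib)
  qed
  finally show ?thesis .
qed

lemma four_power_sum_3:
  fixes x y z :: "'a::comm_ring_1"
  assumes "CHAR('a) = 2"
  shows "four_power_sum x y z 3 = (x + y) * (x + z) * (y + z)"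
proof -
  have "four_power_sum x y z 3 = (x + y) * (x + z) * (y + z)
      + 2 * ((x + y) * (x + z) * (y + z) + x ^ 3 + y ^ 3 + z ^ 3)"
    by (simp add: four_power_sum_def power3_eq_cube algebra_simps)
  then show ?thesis by (simp add: two_eq_0[OF assms])
qed

lemma exists_not_0_1:
  assumes "CHAR('a::alg_closed_field) = 2"
  obtains \<beta> :: "'a::alg_closed_field" where "\<beta> \<noteq> 0" "\<beta> \<noteq> 1"
proof -
  obtain \<beta> :: 'a where "poly [:1, 1, 1:] \<beta> = 0"
    using alg_closed_imp_poly_has_root[of "[:1, 1, 1:] :: 'a poly"] by auto
  then have "\<beta> \<noteq> 0" "\<beta> \<noteq> 1"
    using two_eq_0[OF assms] by auto
  then show thesis by (rule that)
qed

text \<open>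
  The denominator vanishes at \<open>(1, 1, 1)\<close>, so the value is computed by approaching that point along
  \<open>(1 + \<epsilon>, 1 + \<beta> \<epsilon>, 1)\<close>, where the denominator has order exactly 3 in \<open>\<epsilon>\<close>. Modulo
  \<open>\<epsilon>^4\<close> the fourth power of each of the four arguments is 1, hence each \<open>d\<close>-th power may be
  replaced by a cube, and the sum of four cubes is the denominator itself.
\<close>
lemma eval_at_1_1_1_coeff_dilate:
  fixes \<Phi> :: "'a::alg_closed_field poly3"
  assumes ch: "CHAR('a) = 2" and \<Phi>: "\<Phi> * phi_den = phi_num f" and d: "d mod 4 = 3"
  shows "eval_at 1 1 1 (Polynomial.coeff (dilate \<Phi>) (d - 3)) = Polynomial.coeff f d"
proof -
  obtain \<beta> :: 'a where \<beta>: "\<beta> \<noteq> 0" "\<beta> \<noteq> 1"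
    using exists_not_0_1[OF ch] .
  define m where "m = d div 4"
  have dm: "d = 4 * m + 3" using d by (simp add: m_def) presburger
  then have d3: "d - 3 + 3 = d" by simp
  let ?X = "[:1, 1:] :: 'a poly" and ?Y = "[:1, \<beta>:]"
  interpret \<sigma>: rhom "eval_along ?X ?Y 1" by (rule rhom_eval_along)
  define c where "c = eval_along ?X ?Y 1 (Polynomial.coeff (dilate \<Phi>) (d - 3))"
  define t where "t = [:Polynomial.coeff f d:]"
  define D where "D = (?X + ?Y) * (?X + 1) * (?Y + 1)"
  have ch': "CHAR('a poly) = 2" using ch by simp
  have two: "(2::'a) = 0" by (rule two_eq_0[OF ch])
  have cD: "c * D = t * four_power_sum ?X ?Y 1 d"
    using arg_cong[OF coeff_dilate_quotient[OF \<Phi>, of "d - 3"], of "eval_along ?X ?Y 1"]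
    by (simp only: d3 \<sigma>.mult hom_four_power_sum[OF rhom_eval_along] hom_den[OF rhom_const] ev3_simps[OF rhom_const]
        c_def t_def D_def)
  have dvd: "[:0, 1:] ^ 4 dvd u ^ d - u ^ 3" if "[:0, 1:] dvd u - 1" for u :: "'a poly"
    unfolding dm by (rule power_diff_cube_dvd[OF ch that])
  have lin: "[:0, 1:] dvd [:1, s:] - (1 :: 'a poly)" for s
    by (rule dvdI[of _ _ "[:s:]"]) (simp add: one_pCons)
  have s: "?X + ?Y + 1 = [:1, 1 + \<beta>:]"
    using two by (simp add: one_pCons)
  have "four_power_sum ?X ?Y 1 d - D = (?X ^ d - ?X ^ 3) + (?Y ^ d - ?Y ^ 3) + (1 ^ d - 1 ^ 3)
      + ([:1, 1 + \<beta>:] ^ d - [:1, 1 + \<beta>:] ^ 3)"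
    unfolding D_def four_power_sum_3[OF ch', symmetric] by (simp only: four_power_sum_def s) (simp add: algebra_simps)
  also have "[:0, 1:] ^ 4 dvd \<dots>"
    by (intro dvd_add dvd lin) simp
  finally have "[:0, 1:] ^ 4 dvd t * (four_power_sum ?X ?Y 1 d - D)"
    by (rule dvd_mult)
  also have "t * (four_power_sum ?X ?Y 1 d - D) = (c - t) * D"
    by (simp only: left_diff_distrib right_diff_distrib cD)
  also have "D = [:0, 1:] ^ 3 * [:(1 + \<beta>) * \<beta>:]"
    using two by (simp add: D_def one_pCons power3_eq_cube algebra_simps)
  finally have "[:0, 1:] ^ 3 * [:0, 1:] dvd [:0, 1:] ^ 3 * ((c - t) * [:(1 + \<beta>) * \<beta>:])"
    by (simp only: power_Suc2[symmetric] mult_ac) (simp add: numeral_eq_Suc)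
  then have "[:0, 1:] dvd (c - t) * [:(1 + \<beta>) * \<beta>:]"
    by (subst (asm) dvd_mult_cancel_left) simp
  then have "poly ((c - t) * [:(1 + \<beta>) * \<beta>:]) 0 = 0"
    unfolding poly_eq_0_iff_dvd by (simp only: minus_zero)
  moreover have "1 + \<beta> \<noteq> 0"
    using \<beta>(2) by (simp only: add.commute[of 1] add_eq_0_iff2 uminus_CHAR_2[OF ch] not_False_eq_True)
  ultimately have "poly c 0 = Polynomial.coeff f d"
    using \<beta> by (simp add: t_def)
  then show ?thesis by (simp add: c_def poly_eval_along)
qed

section \<open>Irreducibility over an algebraically closed field\<close>

context kasami
begin

lemma dilate_quotient:
  fixes \<Phi> :: "'a::field poly3"
  assumes ch: "CHAR('a) = 2" and \<Phi>: "\<Phi> * phi_den = phi_num f"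
    and f: "Polynomial.degree f = K" "Polynomial.coeff f K = 1"
  shows "\<Phi> \<noteq> 0" and "Polynomial.degree (dilate \<Phi>) + 3 = K"
    and "Polynomial.lead_coeff (dilate \<Phi>) * phi_den = four_power_sum var_x var_y var_z K"
proof -
  have "eval_along [:0, 1:] 0 1 (four_power_sum var_x var_y var_z K) \<noteq> (0 :: 'a poly)"
    using degree_kasami_slice(2)[OF ch]
    by (simp only: hom_four_power_sum[OF rhom_eval_along] ev3_simps[OF rhom_const]
        not_False_eq_True)
  then have N: "four_power_sum var_x var_y var_z K \<noteq> (0 :: 'a poly3)"
    using rhom.zero[OF rhom_eval_along] by metis
  have K3: "K - 3 + 3 = K" using K_ge_3 by simp
  have top: "Polynomial.coeff (dilate \<Phi>) (K - 3) * phi_den = four_power_sum var_x var_y var_z K"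
    using coeff_dilate_quotient[OF \<Phi>, of "K - 3"] by (simp only: K3 f rhom.one[OF rhom_const3] mult_1)
  have "Polynomial.coeff (dilate \<Phi>) j = 0" if "j > K - 3" for j
  proof -
    have "Polynomial.coeff f (j + 3) = 0"
      using that f(1) by (intro coeff_eq_0) linarith
    then show ?thesis
      using coeff_dilate_quotient[OF \<Phi>, of j]
      by (simp add: rhom.zero[OF rhom_const3] phi_den_nonzero)
  qed
  then have "Polynomial.degree (dilate \<Phi>) \<le> K - 3"
    by (intro degree_le) blast
  moreover have "Polynomial.coeff (dilate \<Phi>) (K - 3) \<noteq> 0"
    using top N by auto
  ultimately have deg: "Polynomial.degree (dilate \<Phi>) = K - 3"
    using le_degree by (metis order_antisym)
  then show "Polynomial.degree (dilate \<Phi>) + 3 = K" by (simp add: K3)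
  show "Polynomial.lead_coeff (dilate \<Phi>) * phi_den = four_power_sum var_x var_y var_z K"
    unfolding deg by (rule top)
  show "\<Phi> \<noteq> 0"
    using top N by (auto simp: rhom.zero[OF rhom_dilate])
qed

text \<open>
  Beyond the exponents up to \<open>d\<close> only \<open>K\<close> contributes to the quotient, and on the cone over a curve
  in the zero set of the leading form of \<open>A\<close> the contribution of \<open>K\<close> disappears as well. Since
  \<open>B\<close> keeps its degree on that cone, all of the drop in degree falls to \<open>A\<close>.
\<close>
lemma degree_on_diagonal:
  fixes A B :: "'a::alg_closed_field poly3"
  assumes ch: "CHAR('a) = 2" and fac: "A * B * phi_den = phi_num f"
    and f: "Polynomial.degree f = K" "Polynomial.coeff f K = 1"
    and gap: "\<And>j. j > d \<Longrightarrow> j \<noteq> K \<Longrightarrow> Polynomial.coeff f j = 0"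
    and A: "Polynomial.degree (dilate A) > 0"
  shows "map_poly (eval_at 1 1 1) (dilate A) = 0 \<or>
    Polynomial.degree (map_poly (eval_at 1 1 1) (dilate A)) + Polynomial.degree (dilate B) + 3 \<le> d"
proof -
  define A' where "A' = Polynomial.lead_coeff (dilate A)"
  define B' where "B' = Polynomial.lead_coeff (dilate B)"
  have AB: "dilate (A * B) = dilate A * dilate B"
    by (rule rhom.mult[OF rhom_dilate])
  note q = dilate_quotient[OF ch fac f]
  have lead: "A' * B' * phi_den = four_power_sum var_x var_y var_z K"
    using q(3) by (simp add: AB lead_coeff_mult A'_def B'_def)
  have "dilate A \<noteq> 0" "dilate B \<noteq> 0" using q(1) by (auto simp: dilate_eq_0_iff)
  then have SU: "Polynomial.degree (dilate A) + Polynomial.degree (dilate B) + 3 = K"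
    using q(2) by (simp add: AB degree_mult_eq)
  obtain \<alpha> where \<alpha>: "\<alpha> ^ q = \<alpha>" "\<alpha> \<noteq> 0" "\<alpha> \<noteq> 1" "eval_at \<alpha> 0 1 A' = 0"
    using zero_on_line_y_0[OF ch lead _ _ SU A]
    unfolding A'_def B'_def using degree_eval_along_line_coeff_dilate by metis
  obtain a where a2: "a ^ 2 = \<alpha>"
    using nth_root_exists[of 2 \<alpha>] by auto
  have "(a ^ q) ^ 2 = a ^ 2"
    using \<alpha>(1) by (simp add: a2[symmetric] power_mult[symmetric] mult.commute)
  then have aq: "a ^ q = a" by (rule square_inj_char_2[OF ch])
  have a01: "a \<noteq> 0" "a \<noteq> 1" using \<alpha> a2 by auto
  note cv = vanishes_on_curve[OF ch lead aq a01 \<alpha>(4)[folded a2]]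
  interpret \<sigma>: rhom "curve a" by (rule rhom_eval_along)
  define p where "p = map_poly (curve a) (dilate A)"
  define r where "r = map_poly (curve a) (dilate B)"
  have pr: "p * r = map_poly (curve a) (dilate (A * B))"
    unfolding p_def r_def AB by (rule rhom.mult[OF rhom_map_poly[OF rhom_eval_along], symmetric])
  have vanish: "Polynomial.coeff (p * r) j = 0" if "j + 3 > d" for j
  proof -
    have "Polynomial.coeff (p * r) j * curve a phi_den
        = curve a (const3 (Polynomial.coeff f (j + 3)) * four_power_sum var_x var_y var_z (j + 3))"
      unfolding pr coeff_dilate_quotient[OF fac, symmetric]
      by (simp only: coeff_map_poly[of "curve a", OF \<sigma>.zero] \<sigma>.mult)
    also have "\<dots> = 0"
    proof (cases "j + 3 = K")
      case True
      then show ?thesis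
        unfolding True lead[symmetric] by (simp only: \<sigma>.mult cv(1)) simp
    next
      case False
      have "const3 (Polynomial.coeff f (j + 3)) * four_power_sum var_x var_y var_z (j + 3) = 0"
        by (simp add: gap[OF that False] rhom.zero[OF rhom_const3])
      then show ?thesis by (simp only: \<sigma>.zero)
    qed
    finally show ?thesis using cv(3) by simp
  qed
  have "Polynomial.coeff r (Polynomial.degree (dilate B)) \<noteq> 0"
    using cv(2) by (simp only: r_def coeff_map_poly[of "curve a", OF \<sigma>.zero] B'_def) simp
  then have r: "r \<noteq> 0" "Polynomial.degree r \<ge> Polynomial.degree (dilate B)"
    by (auto intro: le_degree)
  have diag: "map_poly (eval_at 1 1 1) (dilate A) = map_poly (\<lambda>u. poly u 1) p"
  proof -
    have "a + a = 0"
      using two_eq_0[OF ch] by (simp flip: mult_2)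
    then have "poly [:a, a + 1:] 1 = 1"
      by (simp flip: add.assoc)
    then have at_1: "poly (curve a u) 1 = eval_at 1 1 1 u" for u
      by (simp only: poly_eval_along poly_power) simp
    show ?thesis
      unfolding p_def
      by (subst map_poly_map_poly) (simp_all only: poly_0 o_def \<sigma>.zero at_1)
  qed
  show ?thesis
  proof (cases "p = 0")
    case True
    then show ?thesis by (simp add: diag)
  next
    case False
    with r have "p * r \<noteq> 0" by simp
    then have "Polynomial.coeff (p * r) (Polynomial.degree (p * r)) \<noteq> 0"
      by simp
    then have "Polynomial.degree (p * r) + 3 \<le> d"
      using vanish not_le by blast
    then have "Polynomial.degree p + Polynomial.degree r + 3 \<le> d"
      using False r by (simp add: degree_mult_eq)
    moreover have "Polynomial.degree (map_poly (\<lambda>u. poly u 1) p) \<le> Polynomial.degree p"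
      by (intro degree_le allI impI) (simp add: coeff_map_poly coeff_eq_0)
    ultimately show ?thesis
      unfolding diag using r(2) by linarith
  qed
qed

lemma irreducible_quotient:
  fixes \<Phi> :: "'a::alg_closed_field poly3"
  assumes ch: "CHAR('a) = 2" and \<Phi>: "\<Phi> * phi_den = phi_num f"
    and f: "f = Polynomial.monom 1 K + h"
    and h: "Polynomial.degree h < K" "Polynomial.degree h mod 4 = 3"
  shows "Factorial_Ring.irreducible \<Phi>"
proof (rule irreducibleI)
  define d where "d = Polynomial.degree h"
  have degf: "Polynomial.degree f = K"
    unfolding f using h(1) by (subst degree_add_eq_left) (simp_all add: degree_monom_eq)
  have topf: "Polynomial.coeff f K = 1"
    using h(1) by (simp add: f coeff_eq_0)
  have gap: "Polynomial.coeff f j = 0" if "j > d" "j \<noteq> K" for j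
    using that by (simp add: f d_def coeff_eq_0)
  have d: "d < K" "d mod 4 = 3" "d \<ge> 3" using h mod_less_eq_dividend[of d 4] by (simp_all add: d_def)
  have "h \<noteq> 0" using h(2) by auto
  then have fd: "Polynomial.coeff f d \<noteq> 0"
    using d(1) by (simp add: f d_def)
  note q = dilate_quotient[OF ch \<Phi> degf topf]
  show "\<Phi> \<noteq> 0" by (rule q(1))
  show "\<not> \<Phi> dvd 1"
  proof
    assume "\<Phi> dvd 1"
    then obtain \<Psi> where "1 = \<Phi> * \<Psi>" by (elim dvdE)
    then have "dilate \<Phi> * dilate \<Psi> = 1"
      using rhom.mult[OF rhom_dilate] rhom.one[OF rhom_dilate] by metis
    then have "dilate \<Phi> dvd 1" by (metis dvd_triv_left)
    then have "Polynomial.degree (dilate \<Phi>) = 0"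
      by (auto simp: is_unit_poly_iff)
    with q(2) d show False by simp
  qed
  fix A B
  assume AB: "\<Phi> = A * B"
  show "A dvd 1 \<or> B dvd 1"
  proof (rule ccontr)
    assume nu: "\<not> (A dvd 1 \<or> B dvd 1)"
    have nz: "A \<noteq> 0" "B \<noteq> 0" using q(1) AB by auto
    have pos: "Polynomial.degree (dilate A) > 0" "Polynomial.degree (dilate B) > 0"
      using is_unit_if_dilate_const nu nz by blast+
    have dAB: "dilate \<Phi> = dilate A * dilate B"
      unfolding AB by (rule rhom.mult[OF rhom_dilate])
    have SU: "Polynomial.degree (dilate A) + Polynomial.degree (dilate B) + 3 = K"
      using q(2) nz by (simp add: dAB degree_mult_eq dilate_eq_0_iff)
    define p where "p = map_poly (eval_at 1 1 1) (dilate A)"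
    define r where "r = map_poly (eval_at 1 1 1) (dilate B)"
    have "p * r = map_poly (eval_at 1 1 1) (dilate \<Phi>)"
      unfolding p_def r_def dAB by (rule rhom.mult[OF rhom_map_poly[OF rhom_eval_at], symmetric])
    then have "Polynomial.coeff (p * r) (d - 3) = Polynomial.coeff f d"
      using eval_at_1_1_1_coeff_dilate[OF ch \<Phi> d(2)]
      by (simp add: coeff_map_poly[of "eval_at 1 1 1", OF rhom.zero[OF rhom_eval_at]])
    then have pr: "Polynomial.coeff (p * r) (d - 3) \<noteq> 0" using fd by simp
    then have nz': "p \<noteq> 0" "r \<noteq> 0" by auto
    have "d - 3 \<le> Polynomial.degree p + Polynomial.degree r"
      using le_degree[OF pr] nz' by (simp add: degree_mult_eq)
    moreover have "Polynomial.degree p + Polynomial.degree (dilate B) + 3 \<le> d"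
      using degree_on_diagonal[OF ch \<Phi>[unfolded AB] degf topf gap pos(1)] nz'
      by (auto simp: p_def)
    moreover have "Polynomial.degree r + Polynomial.degree (dilate A) + 3 \<le> d"
      using degree_on_diagonal[OF ch \<Phi>[unfolded AB mult.commute[of A]] degf topf gap pos(2)] nz'
      by (auto simp: r_def)
    \<comment> \<open>Adding up gives \<open>(d - 3) + (K - 3) \<le> 2 (d - 3)\<close>, so \<open>K \<le> d\<close>.\<close>
    ultimately show False using SU d by linarith
  qed
qed

end

section \<open>Base change to the algebraic closure\<close>

definition base_change :: "('a::comm_ring_1 \<Rightarrow> 'b::comm_ring_1) \<Rightarrow> 'a poly3 \<Rightarrow> 'b poly3" where
  "base_change g = map_poly (map_poly (map_poly g))"

lemma base_change_quotient:
  assumes g: "rhom g" and \<Phi>: "\<Phi> * phi_den = phi_num f"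
  shows "base_change g \<Phi> * phi_den = phi_num (map_poly g f)"
proof -
  have t: "rhom (base_change g)"
    unfolding base_change_def by (intro rhom_map_poly g)
  interpret t: rhom "base_change g" by (rule t)
  have g01: "g 0 = 0" "g 1 = 1" using g by (simp_all add: rhom.zero rhom.one)
  have v: "base_change g var_x = var_x" "base_change g var_y = var_y" "base_change g var_z = var_z"
    "base_change g (const3 u) = const3 (g u)" for u
    by (simp_all add: base_change_def var_x_def var_y_def var_z_def const3_def map_poly_pCons g01)
  have s: "base_change g (subst3 f p) = subst3 (map_poly g f) (base_change g p)" for p
    using hom_ev[OF rhom_const3 t, of p f] ev_map_poly[OF g rhom_const3, of "base_change g p" f]
    by (simp add: subst3_def ev_def[symmetric] v)
  have "base_change g \<Phi> * base_change g phi_den = base_change g (phi_num f)"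
    by (simp add: t.mult[symmetric] \<Phi>)
  then show ?thesis
    by (simp add: phi_num_def phi_den_def t.add t.mult s v)
qed

theorem theorem5:
  fixes f h :: "'a::field poly" and n k :: nat
  assumes "n > 0" and "card (UNIV :: 'a set) = 2 ^ n"
    and "k > 0"
    and "f = Polynomial.monom 1 (2 ^ (2 * k) - 2 ^ k + 1) + h"
    and "Polynomial.degree h < 2 ^ (2 * k) - 2 ^ k + 1"
    and "Polynomial.degree h mod 4 = 3"
  shows "absolutely_irreducible (phi f)"
proof -
  have ch: "CHAR('a) = 2" by (rule CHAR_eq_2[OF assms(2)])
  have q: "(2::nat) ^ (2 * k) = 2 ^ k * 2 ^ k" by (simp add: power_add mult_2)
  have le: "(2::nat) ^ k \<le> 2 ^ k * 2 ^ k" by simp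
  interpret kasami k "2 ^ k" "2 ^ (2 * k) - 2 ^ k + 1"
    by unfold_locales (use assms(3) le in \<open>simp_all add: q\<close>)
  have ac: "rhom (to_ac :: 'a \<Rightarrow> 'a alg_closure)"
    by unfold_locales simp_all
  have "map_poly to_ac f = Polynomial.monom 1 (2 ^ (2 * k) - 2 ^ k + 1) + map_poly to_ac h"
    unfolding assms(4) by (simp add: rhom.add[OF rhom_map_poly[OF ac]] map_poly_monom)
  moreover have "Polynomial.degree (map_poly to_ac h) = Polynomial.degree h"
    by (simp add: degree_map_poly)
  ultimately have "Factorial_Ring.irreducible (base_change to_ac (phi f))"
    using irreducible_quotient[OF _ base_change_quotient[OF ac phi_mult_den[OF ch]]] ch assms(5,6)
    by simp
  then show ?thesis
    by (simp add: absolutely_irreducible_def base_change_def)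
qed


end
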